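(* Let $d\ge 2$. Orient each line of $\mathbb{Z}^d$ parallel to a coordinate axis by independent random signs, uniform on $\{-1,+1\}$: for each $i\in\{1,\ldots,d\}$ and each line $\ell$ parallel to the $i$-th axis, let $\varepsilon_i(\ell)\in\{-1,+1\}$ be its orientation. For $x\in\mathbb{Z}^d$ let $\ell_i(x)$ be the line through $x$ parallel to the $i$-th axis, and let $F(x)=x+(\varepsilon_1(\ell_1(x)),\ldots,\varepsilon_d(\ell_d(x)))$. Let $o\in\mathbb{Z}^d$. Then, almost surely, the path $Z_0=o$, $Z_{n+1}=F(Z_n)$ $(n\ge0)$ is bounded. *)

theory Defs
  imports "HOL-Probability.Probability"
begin

text \<open>The lattice is the type \<open>int ^ 'd\<close> with dimension \<open>CARD('d)\<close>; lines parallel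
  to a coordinate axis are sets of lattice points.\<close>

definition axis_line :: "'d \<Rightarrow> int ^ 'd \<Rightarrow> (int ^ 'd) set"
  where "axis_line i x = {x + axis i t |t. True}"

definition axis_lines :: "'d \<Rightarrow> (int ^ 'd) set set"
  where "axis_lines i = range (axis_line i)"

text \<open>Only the values \<open>e i l\<close> with \<open>l \<in> axis_lines i\<close> are ever used.\<close>

definition step :: "('d \<Rightarrow> (int ^ 'd) set \<Rightarrow> int) \<Rightarrow> int ^ 'd \<Rightarrow> int ^ 'd"
  where "step e x = x + (\<chi> i. e i (axis_line i x))"

primrec walk :: "('d \<Rightarrow> (int ^ 'd) set \<Rightarrow> int) \<Rightarrow> int ^ 'd \<Rightarrow> nat \<Rightarrow> int ^ 'd"
  where
    "walk e z 0 = z"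
  | "walk e z (Suc n) = step e (walk e z n)"

text \<open>The embedding of the lattice into Euclidean space, used to speak of bounded sets of
  lattice points (\<open>int\<close> is not an instance of the metric space class).\<close>

definition to_real_vec :: "int ^ 'd \<Rightarrow> real ^ 'd"
  where "to_real_vec x = (\<chi> i. real_of_int (x $ i))"

end

theory Submission
  imports Defs
begin

text \<open>
  Fix a coordinate \<open>a\<close> and a sign \<open>s\<close>, and call \<open>n\<close> a record time if \<open>s\<close> times the
  \<open>a\<close>-coordinate of the path is strictly larger at time \<open>n\<close> than ever before. An unbounded path
  has infinitely many record times for some \<open>a\<close> and \<open>s\<close>, so it is enough to show that then, almost
  surely, the path is eventually caught in a cycle of length two.

  A line parallel to an axis \<open>i \<noteq> a\<close> has a constant \<open>a\<close>-coordinate. So at a record time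
  the path stands on such lines for the first time, and the components of the next step other than
  the \<open>a\<close>-component are independent fair signs given the past. Suppose that the \<open>a\<close>-component of
  the next step is \<open>-s\<close>. The step that produced the record had \<open>a\<close>-component \<open>s\<close>, so with
  probability at least \<open>(1/2)\<^sup>d\<close> the next step is exactly opposite to the previous one. The path is
  then back where it was two steps earlier, and it alternates between two points forever.
  Hence infinitely many records followed by a step backwards in direction \<open>a\<close> trap the path almost
  surely.

  Otherwise every late record is followed by a step forwards, so all late times are record times.
  If the path met an unseen line parallel to the axis \<open>a\<close> at infinitely many of them, it would again
  have infinitely many chances of a complete reversal. So all late lines parallel to \<open>a\<close> have
  been met before; since such a line determines the other coordinates, a second coordinate \<open>b\<close>
  takes only finitely many values, and it takes one value \<open>h\<close> infinitely often. But its steps are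
  fresh fair signs at record times, so it also takes \<open>h + 1\<close> infinitely often, then \<open>h + 2\<close>, and so
  on, which is a contradiction. The second coordinate is where \<open>d \<ge> 2\<close> enters.

  Each passage from infinitely many chances to a success is an instance of
  \<open>infinitely_many_successes\<close>, a conditional Borel--Cantelli lemma along a discrete history.
  Its hypothesis is verified by \<open>prob_history_fresh_signs\<close>: a finite initial piece of the path is an
  event about the finitely many lines met so far, hence independent of the fresh ones.
  The argument above is \<open>AE_records_imp_backtrack\<close>.
\<close>

section \<open>Repeated trials along a history\<close>

lemma (in prob_space) history_event_measurable:
  fixes H :: "'a \<Rightarrow> 'h"
  assumes H: "H \<in> measurable M (count_space UNIV)"
    and det: "\<And>w w'. w \<in> space M \<Longrightarrow> w' \<in> space M \<Longrightarrow> H w = H w' \<Longrightarrow> P w \<Longrightarrow> P w'"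
  shows "{w \<in> space M. P w} \<in> events"
proof -
  have "{w \<in> space M. P w} = H -` (H ` {w \<in> space M. P w}) \<inter> space M"
  proof (intro equalityI subsetI)
    fix w assume "w \<in> H -` (H ` {w \<in> space M. P w}) \<inter> space M"
    then obtain v where "v \<in> space M" "P v" "H v = H w" "w \<in> space M" by force
    then show "w \<in> {w \<in> space M. P w}" using det[of v w] by simp
  qed auto
  then show ?thesis
    using measurable_sets[OF H, of "H ` {w \<in> space M. P w}"] by simp
qed

text \<open>Conditional bounds given each value of a discrete history add up: an event determined by the
  history is a countable disjoint union of such values.\<close>

lemma (in prob_space) failure_emeasure_le:
  fixes H :: "'a \<Rightarrow> 'h::countable"
  assumes H: "H \<in> measurable M (count_space UNIV)"
    and det: "\<And>w w'. w \<in> space M \<Longrightarrow> w' \<in> space M \<Longrightarrow> H w = H w' \<Longrightarrow> P w \<Longrightarrow> P w'"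
    and S: "{w \<in> space M. S w} \<in> events"
    and "0 \<le> q"
    and le: "\<And>v. v \<in> space M \<Longrightarrow> P v \<Longrightarrow>
      prob {w \<in> space M. H w = H v \<and> \<not> S w} \<le> q * prob {w \<in> space M. H w = H v}"
  shows "emeasure M {w \<in> space M. P w \<and> \<not> S w} \<le> ennreal q * emeasure M {w \<in> space M. P w}"
proof -
  define I where "I = H ` {w \<in> space M. P w}"
  have atom: "{w \<in> space M. H w = h} \<in> events" for h
    by (rule history_event_measurable[OF H]) simp
  have atom': "{w \<in> space M. H w = h \<and> \<not> S w} \<in> events" for h
  proof -
    have "{w \<in> space M. H w = h \<and> \<not> S w} = {w \<in> space M. H w = h} - {w \<in> space M. S w}"
      by auto
    then show ?thesis using atom S by simp
  qed
  have hist_I: "H w \<in> I \<longleftrightarrow> P w" if "w \<in> space M" for w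
    using det[OF _ that] that unfolding I_def by force
  then have split: "{w \<in> space M. P w} = (\<Union>h\<in>I. {w \<in> space M. H w = h})"
    by auto
  have split': "{w \<in> space M. P w \<and> \<not> S w} = (\<Union>h\<in>I. {w \<in> space M. H w = h \<and> \<not> S w})"
    using hist_I by auto
  have "emeasure M {w \<in> space M. P w \<and> \<not> S w}
      = (\<integral>\<^sup>+h. emeasure M {w \<in> space M. H w = h \<and> \<not> S w} \<partial>count_space I)"
    unfolding split' by (rule emeasure_UN_countable) (use atom' in \<open>auto simp: disjoint_family_on_def\<close>)
  also have "\<dots> \<le> (\<integral>\<^sup>+h. ennreal q * emeasure M {w \<in> space M. H w = h} \<partial>count_space I)"
  proof (rule nn_integral_mono)
    fix h assume "h \<in> space (count_space I)"
    then obtain v where "v \<in> space M" "P v" "h = H v"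
      by (auto simp: I_def)
    then show "emeasure M {w \<in> space M. H w = h \<and> \<not> S w} \<le> ennreal q * emeasure M {w \<in> space M. H w = h}"
      using le[of v] \<open>0 \<le> q\<close> by (simp add: emeasure_eq_measure flip: ennreal_mult)
  qed
  also have "\<dots> = ennreal q * (\<integral>\<^sup>+h. emeasure M {w \<in> space M. H w = h} \<partial>count_space I)"
    by (rule nn_integral_cmult) simp
  also have "(\<integral>\<^sup>+h. emeasure M {w \<in> space M. H w = h} \<partial>count_space I) = emeasure M {w \<in> space M. P w}"
    unfolding split by (rule emeasure_UN_countable[symmetric]) (use atom in \<open>auto simp: disjoint_family_on_def\<close>)
  finally show ?thesis .
qed

lemma infinite_imp_exact_count_before:
  fixes A :: "nat set"
  assumes "infinite A"
  shows "\<exists>n\<in>A. card (A \<inter> {..<n}) = k"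
proof (induction k)
  case 0
  obtain a where "a \<in> A" using assms infinite_imp_nonempty by blast
  then have "(LEAST n. n \<in> A) \<in> A" by (rule LeastI)
  moreover have "A \<inter> {..<(LEAST n. n \<in> A)} = {}" using not_less_Least by auto
  ultimately show ?case by (metis card.empty)
next
  case (Suc k)
  then obtain n where n: "n \<in> A" "card (A \<inter> {..<n}) = k" by blast
  define n' where "n' = (LEAST j. j \<in> A \<and> n < j)"
  have "\<exists>j. j \<in> A \<and> n < j" using assms by (meson finite_nat_set_iff_bounded_le not_le)
  then have n': "n' \<in> A" "n < n'" unfolding n'_def by (metis (mono_tags, lifting) LeastI_ex)+
  have "j \<le> n" if "j \<in> A" "j < n'" for j
    using that not_less_Least[of j "\<lambda>j. j \<in> A \<and> n < j"] unfolding n'_def by (meson not_le)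
  then have "A \<inter> {..<n'} = insert n (A \<inter> {..<n})"
    using n n' by force
  then have "card (A \<inter> {..<n'}) = Suc k" using n by simp
  with n' show ?case by blast
qed

text \<open>A conditional Borel--Cantelli lemma. Given the history, each trial fails with probability at
  most \<open>q < 1\<close>, so the event \<open>D m k\<close> that at least \<open>k + 1\<close> trials take place from time \<open>m\<close> on and
  that the first \<open>k\<close> of them fail has probability at most \<open>q ^ k\<close>. If there are infinitely many trials
  and only finitely many successes, then for some \<open>m\<close> all the events \<open>D m k\<close> occur.\<close>

lemma (in prob_space) infinitely_many_successes:
  fixes H :: "nat \<Rightarrow> 'a \<Rightarrow> 'h::countable"
  assumes H: "\<And>n. H n \<in> measurable M (count_space UNIV)"
    and refine: "\<And>m n w w'. m \<le> n \<Longrightarrow> H n w = H n w' \<Longrightarrow> H m w = H m w'"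
    and trial_det: "\<And>n w w'. H n w = H n w' \<Longrightarrow> trial n w = trial n w'"
    and S_det: "\<And>n w w'. H (Suc n) w = H (Suc n) w' \<Longrightarrow> S n w = S n w'"
    and q: "0 \<le> q" "q < 1"
    and le: "\<And>n v. v \<in> space M \<Longrightarrow> trial n v \<Longrightarrow>
      prob {w \<in> space M. H n w = H n v \<and> \<not> S n w} \<le> q * prob {w \<in> space M. H n w = H n v}"
  shows "AE w in M. (\<exists>\<^sub>\<infinity>n. trial n w) \<longrightarrow> (\<exists>\<^sub>\<infinity>n. trial n w \<and> S n w)"
proof -
  define T where "T m k n w \<longleftrightarrow> trial n w \<and> m \<le> n \<and> card {j \<in> {m..<n}. trial j w} = k
      \<and> (\<forall>j\<in>{m..<n}. trial j w \<longrightarrow> \<not> S j w)" for m k n w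
  have T_det: "T m k n w'" if "H n w = H n w'" "T m k n w" for m k n w w'
  proof -
    have "trial j w = trial j w'" if "j \<le> n" for j
      using trial_det[of j w w'] refine[OF that] \<open>H n w = H n w'\<close> by blast
    moreover have "S j w = S j w'" if "j < n" for j
      using S_det[of j w w'] refine[of "Suc j" n w w'] that \<open>H n w = H n w'\<close> by auto
    ultimately show ?thesis
      using \<open>T m k n w\<close> unfolding T_def by (auto cong: conj_cong)
  qed
  have T_meas: "{w \<in> space M. T m k n w} \<in> events" for m k n
    by (rule history_event_measurable[OF H[of n]]) (use T_det in blast)
  have S_meas: "{w \<in> space M. S n w} \<in> events" for n
    by (rule history_event_measurable[OF H[of "Suc n"]]) (use S_det in blast)
  have T_unique: "n = n'" if "T m k n w" "T m k n' w" for m k n n' w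
  proof -
    have less: False if "n < n'" "T m k n w" "T m k n' w" for n n'
    proof -
      have "insert n {j \<in> {m..<n}. trial j w} \<subseteq> {j \<in> {m..<n'}. trial j w}"
        using that unfolding T_def by auto
      then have "card (insert n {j \<in> {m..<n}. trial j w}) \<le> card {j \<in> {m..<n'}. trial j w}"
        by (intro card_mono) auto
      then show False using that unfolding T_def by simp
    qed
    show ?thesis using less that by (metis linorder_neqE_nat)
  qed
  \<comment> \<open>For different \<open>n\<close> the events \<open>T m k n\<close> are disjoint, so their measures can be summed over
    the random time \<open>n\<close> of the trial with number \<open>k\<close>.\<close>
  define D where "D m k = (\<Union>n. {w \<in> space M. T m k n w})" for m k
  have D_meas: "D m k \<in> events" for m k unfolding D_def using T_meas by auto
  have D_step: "emeasure M (D m (Suc k)) \<le> ennreal q * emeasure M (D m k)" for m k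
  proof -
    have fail_meas: "{w \<in> space M. T m k n w \<and> \<not> S n w} \<in> events" for n
    proof -
      have "{w \<in> space M. T m k n w \<and> \<not> S n w} = {w \<in> space M. T m k n w} - {w \<in> space M. S n w}"
        by auto
      then show ?thesis using T_meas S_meas by simp
    qed
    have "D m (Suc k) \<subseteq> (\<Union>n. {w \<in> space M. T m k n w \<and> \<not> S n w})"
    proof
      fix w assume "w \<in> D m (Suc k)"
      then obtain n where w: "w \<in> space M" and n: "T m (Suc k) n w" unfolding D_def by auto
      \<comment> \<open>The last trial before \<open>n\<close> is the one counted in \<open>T m k\<close>, and it failed.\<close>
      define B where "B = {j \<in> {m..<n}. trial j w}"
      have B: "finite B" "card B = Suc k" using n unfolding T_def B_def by auto
      then have "B \<noteq> {}" by auto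
      have "Max B \<in> B" using \<open>B \<noteq> {}\<close> B by simp
      have "{j \<in> {m..<Max B}. trial j w} = B - {Max B}"
      proof (intro equalityI subsetI)
        fix j assume "j \<in> {j \<in> {m..<Max B}. trial j w}"
        then show "j \<in> B - {Max B}" using \<open>Max B \<in> B\<close> by (simp add: B_def)
      next
        fix j assume "j \<in> B - {Max B}"
        then have "j < Max B" "j \<in> B" using Max_ge[OF B(1), of j] by auto
        then show "j \<in> {j \<in> {m..<Max B}. trial j w}" by (simp add: B_def)
      qed
      then have "T m k (Max B) w" "\<not> S (Max B) w"
        using n \<open>Max B \<in> B\<close> B unfolding T_def by (auto simp: B_def)
      then show "w \<in> (\<Union>n. {w \<in> space M. T m k n w \<and> \<not> S n w})" using w by auto
    qed
    then have "emeasure M (D m (Suc k)) \<le> emeasure M (\<Union>n. {w \<in> space M. T m k n w \<and> \<not> S n w})"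
      using fail_meas by (intro emeasure_mono) auto
    also have "\<dots> \<le> (\<Sum>n. emeasure M {w \<in> space M. T m k n w \<and> \<not> S n w})"
      using fail_meas by (intro emeasure_subadditive_countably) auto
    also have "\<dots> \<le> (\<Sum>n. ennreal q * emeasure M {w \<in> space M. T m k n w})"
    proof (rule suminf_le[OF _ summableI summableI])
      fix n
      show "emeasure M {w \<in> space M. T m k n w \<and> \<not> S n w}
          \<le> ennreal q * emeasure M {w \<in> space M. T m k n w}"
      proof (rule failure_emeasure_le[OF H[of n]])
        show "T m k n w'" if "H n w = H n w'" "T m k n w" for w w'
          by (rule T_det[OF that])
        show "prob {w \<in> space M. H n w = H n v \<and> \<not> S n w}
            \<le> q * prob {w \<in> space M. H n w = H n v}" if "v \<in> space M" "T m k n v" for v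
          by (rule le) (use that in \<open>auto simp: T_def\<close>)
      qed (use S_meas q in auto)
    qed
    also have "\<dots> = ennreal q * (\<Sum>n. emeasure M {w \<in> space M. T m k n w})"
      by simp
    also have "(\<Sum>n. emeasure M {w \<in> space M. T m k n w}) = emeasure M (D m k)"
      unfolding D_def
    proof (rule suminf_emeasure)
      show "range (\<lambda>n. {w \<in> space M. T m k n w}) \<subseteq> events" using T_meas by auto
      show "disjoint_family (\<lambda>n. {w \<in> space M. T m k n w})"
        using T_unique unfolding disjoint_family_on_def by blast
    qed
    finally show ?thesis .
  qed
  have D_le: "emeasure M (D m k) \<le> ennreal (q ^ k)" for m k
  proof (induction k)
    case 0
    then show ?case by (simp add: emeasure_le_1)
  next
    case (Suc k)
    have "emeasure M (D m (Suc k)) \<le> ennreal q * ennreal (q ^ k)"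
      using D_step[of m k] Suc by (meson mult_left_mono order_trans zero_le)
    then show ?case using q by (simp add: ennreal_mult)
  qed
  have null: "(\<Inter>k. D m k) \<in> null_sets M" for m
  proof -
    have meas: "(\<Inter>k. D m k) \<in> events" using D_meas by auto
    have le: "prob (\<Inter>k. D m k) \<le> q ^ k" for k
    proof -
      have "prob (\<Inter>k. D m k) \<le> prob (D m k)"
        using D_meas by (intro finite_measure_mono) auto
      also have "\<dots> \<le> q ^ k" using D_le[of m k] q by (simp add: emeasure_eq_measure)
      finally show ?thesis .
    qed
    have "(\<lambda>k. q ^ k) \<longlonglongrightarrow> 0" using q by (intro LIMSEQ_realpow_zero) auto
    then have "prob (\<Inter>k. D m k) \<le> 0"
      by (rule LIMSEQ_le_const) (use le in blast)
    then have "prob (\<Inter>k. D m k) = 0" using measure_nonneg[of M "\<Inter>k. D m k"] by linarith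
    then show ?thesis using meas by (intro null_setsI) (simp add: emeasure_eq_measure)
  qed
  have "AE w in M. \<forall>m. w \<notin> (\<Inter>k. D m k)"
    using AE_not_in[OF null] by (subst AE_all_countable) blast
  moreover have "AE w in M. w \<in> space M" by simp
  ultimately show ?thesis
  proof eventually_elim
    case (elim w)
    show ?case
    proof (intro impI, rule ccontr)
      assume inf: "\<exists>\<^sub>\<infinity>n. trial n w" and "\<not> (\<exists>\<^sub>\<infinity>n. trial n w \<and> S n w)"
      then obtain m where m: "\<And>n. n \<ge> m \<Longrightarrow> trial n w \<Longrightarrow> \<not> S n w"
        unfolding INFM_nat_le by auto
      define A where "A = {n. m \<le> n \<and> trial n w}"
      have "infinite A"
        using inf unfolding A_def INFM_nat_le infinite_nat_iff_unbounded_le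
        by (metis (mono_tags, lifting) max.bounded_iff mem_Collect_eq)
      then have "\<exists>n\<in>A. card (A \<inter> {..<n}) = k" for k
        by (rule infinite_imp_exact_count_before)
      moreover have "A \<inter> {..<n} = {j \<in> {m..<n}. trial j w}" for n
        unfolding A_def by auto
      ultimately have "\<exists>n. T m k n w" for k
        using m unfolding T_def A_def by fastforce
      then have "w \<in> (\<Inter>k. D m k)" using elim unfolding D_def by auto
      with elim show False by blast
    qed
  qed
qed

lemma (in prob_space) indep_vars_prob_Ball:
  assumes X: "indep_vars (\<lambda>_. count_space UNIV) X I"
    and L: "finite L" "L \<subseteq> I"
  shows "prob {w \<in> space M. \<forall>l\<in>L. X l w \<in> V l} = (\<Prod>l\<in>L. prob {w \<in> space M. X l w \<in> V l})"
proof (cases "L = {}")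
  case True
  then show ?thesis by (simp add: prob_space)
next
  case False
  have "{w \<in> space M. \<forall>l\<in>L. X l w \<in> V l} = (\<Inter>l\<in>L. X l -` V l \<inter> space M)"
    using False by auto
  moreover have "X l -` V l \<inter> space M = {w \<in> space M. X l w \<in> V l}" for l by auto
  ultimately show ?thesis
    using indep_varsD[OF X False L, of V] by simp
qed

lemma (in prob_space) indep_vars_prob_Ball_disjoint:
  assumes X: "indep_vars (\<lambda>_. count_space UNIV) X I"
    and L: "finite L" "L \<subseteq> I" and J: "finite J" "J \<subseteq> I" and disj: "L \<inter> J = {}"
  shows "prob {w \<in> space M. (\<forall>l\<in>L. X l w \<in> V l) \<and> (\<forall>l\<in>J. X l w \<in> W l)}
       = prob {w \<in> space M. \<forall>l\<in>L. X l w \<in> V l} * (\<Prod>l\<in>J. prob {w \<in> space M. X l w \<in> W l})"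
proof -
  define U where "U l = (if l \<in> L then V l else W l)" for l
  have U: "U l = V l" if "l \<in> L" for l using that by (simp add: U_def)
  have U': "U l = W l" if "l \<in> J" for l using that disj by (auto simp: U_def)
  have "{w \<in> space M. (\<forall>l\<in>L. X l w \<in> V l) \<and> (\<forall>l\<in>J. X l w \<in> W l)}
      = {w \<in> space M. \<forall>l\<in>L \<union> J. X l w \<in> U l}"
    by (simp add: Un_iff ball_Un U U' cong: ball_cong)
  then have "prob {w \<in> space M. (\<forall>l\<in>L. X l w \<in> V l) \<and> (\<forall>l\<in>J. X l w \<in> W l)}
      = (\<Prod>l\<in>L \<union> J. prob {w \<in> space M. X l w \<in> U l})"
    using indep_vars_prob_Ball[OF X, of "L \<union> J" U] L J by simp
  also have "\<dots> = (\<Prod>l\<in>L. prob {w \<in> space M. X l w \<in> U l}) * (\<Prod>l\<in>J. prob {w \<in> space M. X l w \<in> U l})"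
    using L J disj by (intro prod.union_disjoint) auto
  also have "\<dots> = (\<Prod>l\<in>L. prob {w \<in> space M. X l w \<in> V l}) * (\<Prod>l\<in>J. prob {w \<in> space M. X l w \<in> W l})"
    using U U' by simp
  finally show ?thesis
    using indep_vars_prob_Ball[OF X L] by simp
qed

section \<open>Lines and initial pieces of the path\<close>

lemma axis_line_eq_iff:
  fixes x y :: "int ^ 'd::finite"
  shows "axis_line i x = axis_line i y \<longleftrightarrow> (\<forall>j. j \<noteq> i \<longrightarrow> x $ j = y $ j)"
proof
  assume "axis_line i x = axis_line i y"
  moreover have "x \<in> axis_line i x"
    unfolding axis_line_def by (auto intro!: exI[of _ 0] simp: vec_eq_iff axis_def)
  ultimately obtain t where "x = y + axis i t" unfolding axis_line_def by auto
  then show "\<forall>j. j \<noteq> i \<longrightarrow> x $ j = y $ j" by (auto simp: axis_def)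
next
  have shift: "axis_line i x \<subseteq> axis_line i y" if "\<forall>j. j \<noteq> i \<longrightarrow> x $ j = y $ j" for x y :: "int ^ 'd"
  proof
    fix u assume "u \<in> axis_line i x"
    then obtain t where u: "u = x + axis i t" unfolding axis_line_def by auto
    have "u = y + axis i (x $ i - y $ i + t)"
      using that by (auto simp: u vec_eq_iff axis_def)
    then show "u \<in> axis_line i y" unfolding axis_line_def by auto
  qed
  assume "\<forall>j. j \<noteq> i \<longrightarrow> x $ j = y $ j"
  then show "axis_line i x = axis_line i y" using shift[of x y] shift[of y x] by auto
qed

lemma axis_line_in_axis_lines: "axis_line i x \<in> axis_lines i"
  by (simp add: axis_lines_def)

lemma walk_Suc_nth: "walk e z (Suc n) $ i = walk e z n $ i + e i (axis_line i (walk e z n))"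
  by (simp add: step_def)

text \<open>An initial piece of the path is described by the orientations of the lines through its points
  alone. The right-hand side evaluates orientations only at the given points \<open>p k\<close>, which
  turns an event about the path into a cylinder event.\<close>

lemma walk_prefix_iff:
  "(\<forall>k\<le>n. walk e z k = p k) \<longleftrightarrow>
   p 0 = z \<and> (\<forall>k<n. \<forall>i. e i (axis_line i (p k)) = p (Suc k) $ i - p k $ i)"
proof (induction n)
  case 0
  then show ?case by auto
next
  case (Suc n)
  have "walk e z (Suc n) = p (Suc n) \<longleftrightarrow> (\<forall>i. e i (axis_line i (p n)) = p (Suc n) $ i - p n $ i)"
    if "walk e z n = p n"
    unfolding vec_eq_iff[of "walk e z (Suc n)"] walk_Suc_nth that by (simp add: eq_diff_eq add.commute)
  then show ?case
    using Suc by (auto simp: less_Suc_eq le_Suc_eq simp del: walk.simps)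
qed

text \<open>The sign \<open>s\<close> selects maxima (\<open>s = 1\<close>) or minima (\<open>s = -1\<close>). Every path has a record at time
  0, which has no previous step to be reversed; hence the conditions \<open>0 < n\<close> below.\<close>

definition is_record :: "int \<Rightarrow> 'd \<Rightarrow> nat \<Rightarrow> (nat \<Rightarrow> int ^ 'd) \<Rightarrow> bool"
  where "is_record s i n p \<longleftrightarrow> (\<forall>k<n. s * p k $ i < s * p n $ i)"

section \<open>Fresh lines in the random environment\<close>

locale random_line_orientations = prob_space M
  for M :: "'w measure" +
  fixes eps :: "'d::finite \<Rightarrow> (int ^ 'd) set \<Rightarrow> 'w \<Rightarrow> int" and z :: "int ^ 'd"
  assumes sign: "\<And>i l w. l \<in> axis_lines i \<Longrightarrow> w \<in> space M \<Longrightarrow> eps i l w \<in> {-1, 1}"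
    and indep: "indep_vars (\<lambda>_. count_space UNIV) (\<lambda>(i, l). eps i l) (SIGMA i:UNIV. axis_lines i)"
    and uniform: "\<And>i l. l \<in> axis_lines i \<Longrightarrow>
      distr M (count_space UNIV) (eps i l) = measure_pmf (pmf_of_set {-1, 1})"
begin

abbreviation Z :: "'w \<Rightarrow> nat \<Rightarrow> int ^ 'd"
  where "Z w \<equiv> walk (\<lambda>i l. eps i l w) z"

definition history :: "nat \<Rightarrow> 'w \<Rightarrow> (int ^ 'd) list"
  where "history n w = map (Z w) [0..<Suc n]"

lemma history_eq_iff: "history n w = history n w' \<longleftrightarrow> (\<forall>k\<le>n. Z w k = Z w' k)"
  unfolding history_def by (auto simp: less_Suc_eq_le simp del: upt_Suc)

lemma measurable_eps: "eps i (axis_line i x) \<in> measurable M (count_space UNIV)"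
  using indep axis_line_in_axis_lines unfolding indep_vars_def by fastforce

lemma eps_event [measurable]: "{w \<in> space M. eps i (axis_line i x) w = s} \<in> events"
proof -
  have "{w \<in> space M. eps i (axis_line i x) w = s} = eps i (axis_line i x) -` {s} \<inter> space M"
    by auto
  then show ?thesis using measurable_sets[OF measurable_eps] by auto
qed

lemma prob_eps: "s \<in> {-1, 1} \<Longrightarrow> prob {w \<in> space M. eps i (axis_line i x) w = s} = 1 / 2"
proof -
  assume s: "s \<in> {-1, 1}"
  have "prob {w \<in> space M. eps i (axis_line i x) w = s}
      = measure (distr M (count_space UNIV) (eps i (axis_line i x))) {s}"
    using measurable_eps by (subst measure_distr) (auto intro!: arg_cong[where f = prob])
  also have "\<dots> = pmf (pmf_of_set {-1, 1}) s"
    by (simp add: uniform axis_line_in_axis_lines measure_pmf_single)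
  also have "\<dots> = 1 / 2" using s by (subst pmf_of_set) auto
  finally show ?thesis .
qed

text \<open>The left event is a conjunction of conditions on the lines met before time \<open>n\<close> and on the lines
  through \<open>p n\<close> in the directions \<open>J\<close>. These two families are disjoint. A line can be met
  several times, so its conditions are collected in one set \<open>V l\<close> of admissible signs, which is
  empty if the prescribed piece \<open>p\<close> is contradictory.\<close>

lemma prob_history_fresh_signs:
  assumes fresh: "\<And>i k. i \<in> J \<Longrightarrow> k < n \<Longrightarrow> axis_line i (p k) \<noteq> axis_line i (p n)"
    and v: "\<And>i. i \<in> J \<Longrightarrow> v i \<in> {-1, 1}"
  shows "prob {w \<in> space M. (\<forall>k\<le>n. Z w k = p k) \<and> (\<forall>i\<in>J. eps i (axis_line i (p n)) w = v i)}
       = prob {w \<in> space M. \<forall>k\<le>n. Z w k = p k} * (1 / 2) ^ card J"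
proof (cases "p 0 = z")
  case False
  then have empty: "{w \<in> space M. (\<forall>k\<le>n. Z w k = p k) \<and> Q w} = {}" for Q
    unfolding walk_prefix_iff by blast
  have "{w \<in> space M. \<forall>k\<le>n. Z w k = p k} = {}" using empty[of "\<lambda>_. True"] by simp
  then show ?thesis by (simp only: empty) simp
next
  case True
  define L where "L = (\<lambda>(i, k). (i, axis_line i (p k))) ` (UNIV \<times> {..<n})"
  define V where "V l = {s. \<forall>i. \<forall>k<n. l = (i, axis_line i (p k)) \<longrightarrow> s = p (Suc k) $ i - p k $ i}" for l
  define K where "K = (\<lambda>i. (i, axis_line i (p n))) ` J"
  define X where "X = (\<lambda>(i, l). eps i l)"
  have hist: "(\<forall>k\<le>n. Z w k = p k) \<longleftrightarrow> (\<forall>l\<in>L. X l w \<in> V l)" for w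
    unfolding walk_prefix_iff L_def V_def X_def using True by fastforce
  have next_signs: "(\<forall>i\<in>J. eps i (axis_line i (p n)) w = v i) \<longleftrightarrow> (\<forall>l\<in>K. X l w \<in> {v (fst l)})" for w
    by (simp add: K_def X_def)
  have "prob {w \<in> space M. (\<forall>l\<in>L. X l w \<in> V l) \<and> (\<forall>l\<in>K. X l w \<in> {v (fst l)})}
      = prob {w \<in> space M. \<forall>l\<in>L. X l w \<in> V l} * (\<Prod>l\<in>K. prob {w \<in> space M. X l w \<in> {v (fst l)}})"
  proof (rule indep_vars_prob_Ball_disjoint)
    show "indep_vars (\<lambda>_. count_space UNIV) X (SIGMA i:UNIV. axis_lines i)"
      unfolding X_def by (rule indep)
    show "L \<inter> K = {}" using fresh unfolding L_def K_def by auto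
  qed (auto simp: L_def K_def axis_line_in_axis_lines)
  also have "(\<Prod>l\<in>K. prob {w \<in> space M. X l w \<in> {v (fst l)}}) = (1 / 2) ^ card J"
    unfolding K_def by (subst prod.reindex) (simp_all add: inj_on_def X_def prob_eps[OF v])
  finally show ?thesis by (simp only: hist next_signs)
qed

lemma measurable_history: "history n \<in> measurable M (count_space UNIV)"
proof (subst measurable_count_space_eq2_countable, intro conjI ballI)
  fix h :: "(int ^ 'd) list"
  define p where "p k = h ! k" for k
  have "{w \<in> space M. \<forall>k<n. \<forall>i. eps i (axis_line i (p k)) w = p (Suc k) $ i - p k $ i} \<in> events"
    by measurable
  moreover have "history n -` {h} \<inter> space M =
      (if length h = Suc n \<and> p 0 = z
       then {w \<in> space M. \<forall>k<n. \<forall>i. eps i (axis_line i (p k)) w = p (Suc k) $ i - p k $ i} else {})"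
  proof -
    have "history n w = h \<longleftrightarrow> length h = Suc n \<and> (\<forall>k\<le>n. Z w k = p k)" for w
      unfolding history_def p_def list_eq_iff_nth_eq by (auto simp: less_Suc_eq_le simp del: upt_Suc walk.simps)
    then show ?thesis unfolding walk_prefix_iff by auto
  qed
  ultimately show "history n -` {h} \<inter> space M \<in> events" by simp
qed auto

text \<open>The form in which the Borel--Cantelli lemma is applied: a trial may be any condition on the path
  up to time \<open>n\<close> that makes the lines in the directions \<open>J\<close> fresh, and it succeeds if the next step
  has the components \<open>v\<close>, which may themselves depend on the past.\<close>

lemma fresh_signs_hit_infinitely_often:
  assumes trial_det: "\<And>n p p'. (\<And>k. k \<le> n \<Longrightarrow> p k = p' k) \<Longrightarrow> trial n p = trial n p'"
    and v_det: "\<And>n p p'. (\<And>k. k \<le> n \<Longrightarrow> p k = p' k) \<Longrightarrow> v n p = v n p'"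
    and fresh: "\<And>n p i k. trial n p \<Longrightarrow> i \<in> J \<Longrightarrow> k < n \<Longrightarrow> axis_line i (p k) \<noteq> axis_line i (p n)"
    and v: "\<And>n w i. w \<in> space M \<Longrightarrow> trial n (Z w) \<Longrightarrow> i \<in> J \<Longrightarrow> v n (Z w) i \<in> {-1, 1}"
  shows "AE w in M. (\<exists>\<^sub>\<infinity>n. trial n (Z w)) \<longrightarrow>
    (\<exists>\<^sub>\<infinity>n. trial n (Z w) \<and> (\<forall>i\<in>J. Z w (Suc n) $ i - Z w n $ i = v n (Z w) i))"
proof (rule infinitely_many_successes[where H = history and q = "1 - (1 / 2) ^ card J"])
  show "history n \<in> measurable M (count_space UNIV)" for n by (rule measurable_history)
  show "history m w = history m w'" if "m \<le> n" "history n w = history n w'" for m n w w'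
    using that unfolding history_eq_iff by simp
  show "trial n (Z w) = trial n (Z w')" if "history n w = history n w'" for n w w'
    using that unfolding history_eq_iff by (intro trial_det) simp
  show "(\<forall>i\<in>J. Z w (Suc n) $ i - Z w n $ i = v n (Z w) i)
      = (\<forall>i\<in>J. Z w' (Suc n) $ i - Z w' n $ i = v n (Z w') i)"
    if "history (Suc n) w = history (Suc n) w'" for n w w'
  proof -
    have "v n (Z w) = v n (Z w')" using that unfolding history_eq_iff by (intro v_det) simp
    moreover have "Z w (Suc n) = Z w' (Suc n)" "Z w n = Z w' n"
      using that unfolding history_eq_iff by (simp_all del: walk.simps)
    ultimately show ?thesis by (simp del: walk.simps)
  qed
  show "0 \<le> 1 - (1 / 2 :: real) ^ card J" by (simp add: power_le_one)
  show "1 - (1 / 2 :: real) ^ card J < 1" by simp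
next
  fix n u assume u: "u \<in> space M" "trial n (Z u)"
  let ?A = "{w \<in> space M. history n w = history n u}"
  let ?B = "{w \<in> space M. (\<forall>k\<le>n. Z w k = Z u k) \<and>
    (\<forall>i\<in>J. eps i (axis_line i (Z u n)) w = v n (Z u) i)}"
  have A: "?A = {w \<in> space M. \<forall>k\<le>n. Z w k = Z u k}" by (simp add: history_eq_iff)
  have B: "prob ?B = prob ?A * (1 / 2) ^ card J"
    unfolding A by (rule prob_history_fresh_signs) (use fresh v u in auto)
  have hit: "(\<forall>i\<in>J. Z w (Suc n) $ i - Z w n $ i = v n (Z w) i)
      \<longleftrightarrow> (\<forall>i\<in>J. eps i (axis_line i (Z u n)) w = v n (Z u) i)" if "\<forall>k\<le>n. Z w k = Z u k" for w
    using that v_det[of n "Z w" "Z u"] by (simp add: walk_Suc_nth del: walk.simps)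
  have fail: "{w \<in> space M. history n w = history n u \<and>
      \<not> (\<forall>i\<in>J. Z w (Suc n) $ i - Z w n $ i = v n (Z w) i)} = ?A - ?B"
    unfolding history_eq_iff using hit by blast
  have "?B \<in> events"
  proof -
    have "?B = ?A \<inter> {w \<in> space M. \<forall>i\<in>J. eps i (axis_line i (Z u n)) w = v n (Z u) i}"
      unfolding A by blast
    moreover have "?A \<in> events" by (rule history_event_measurable[OF measurable_history[of n]]) simp
    moreover have "{w \<in> space M. \<forall>i\<in>J. eps i (axis_line i (Z u n)) w = v n (Z u) i} \<in> events"
      by measurable
    ultimately show ?thesis by simp
  qed
  moreover have "?A \<in> events" by (rule history_event_measurable[OF measurable_history[of n]]) simp
  moreover have "?B \<subseteq> ?A" unfolding A by blast
  ultimately have "prob (?A - ?B) = prob ?A - prob ?B"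
    by (intro finite_measure_Diff)
  then show "prob {w \<in> space M. history n w = history n u \<and>
      \<not> (\<forall>i\<in>J. Z w (Suc n) $ i - Z w n $ i = v n (Z w) i)} \<le> (1 - (1 / 2) ^ card J) * prob ?A"
    unfolding fail B by (simp only: algebra_simps)
qed

section \<open>Records trap the path\<close>

lemma step_sign: "w \<in> space M \<Longrightarrow> Z w (Suc n) $ i - Z w n $ i \<in> {-1, 1}"
  using sign[OF axis_line_in_axis_lines] by (simp add: walk_Suc_nth del: walk.simps)

lemma same_line_same_step:
  "axis_line i (Z w m) = axis_line i (Z w n) \<Longrightarrow>
    Z w (Suc m) $ i - Z w m $ i = Z w (Suc n) $ i - Z w n $ i"
  by (simp add: walk_Suc_nth del: walk.simps)

text \<open>The \<open>a\<close>-component of the step after a record need not be fresh, so the records from which the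
  path can be trapped are of two kinds: \<open>blocked\<close> ones, where the line parallel to \<open>a\<close> is already
  known to point backwards and the other signs are fresh, and \<open>unseen\<close> ones, where all signs are fresh.
  In both cases success means that the step is the \<open>reversal\<close> of the previous one. The third kind of
  trial makes the coordinate \<open>b\<close> climb from \<open>h\<close> to \<open>h + 1\<close>.\<close>

lemma AE_records_imp_backtrack:
  fixes a b :: 'd and s :: int
  assumes "a \<noteq> b" and s: "s \<in> {-1, 1}"
  shows "AE w in M. (\<exists>\<^sub>\<infinity>n. is_record s a n (Z w)) \<longrightarrow> (\<exists>n. Z w (Suc (Suc n)) = Z w n)"
proof -
  define blocked where "blocked n p \<longleftrightarrow> is_record s a n p \<and> 0 < n \<and>
    (\<exists>k<n. axis_line a (p k) = axis_line a (p n) \<and> p (Suc k) $ a - p k $ a = - s)"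
    for n and p :: "nat \<Rightarrow> int ^ 'd"
  define unseen where "unseen n p \<longleftrightarrow> is_record s a n p \<and> 0 < n \<and>
    (\<forall>k<n. axis_line a (p k) \<noteq> axis_line a (p n))" for n and p :: "nat \<Rightarrow> int ^ 'd"
  define reversal where "reversal n p i = p (n - 1) $ i - p n $ i" for n i and p :: "nat \<Rightarrow> int ^ 'd"
  have reversal_sign: "reversal n (Z w) i \<in> {-1, 1}" if "w \<in> space M" "0 < n" for n w i
    using step_sign[OF that(1), of "n - 1" i] that(2) unfolding reversal_def by (auto simp del: walk.simps)
  have fresh: "axis_line i (p k) \<noteq> axis_line i (p n)" if "is_record s a n p" "i \<noteq> a" "k < n" for n p i k
    using that unfolding is_record_def axis_line_eq_iff by (metis order_less_irrefl)
  have reversal_cong: "reversal n p = reversal n p'" if "\<And>k. k \<le> n \<Longrightarrow> p k = p' k" for n p p'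
    unfolding reversal_def by (simp add: that)
  have rec_cong: "is_record s a n p = is_record s a n p'" if "\<And>k. k \<le> n \<Longrightarrow> p k = p' k" for n p p'
    unfolding is_record_def by (simp add: that)
  have AE_blocked: "AE w in M. (\<exists>\<^sub>\<infinity>n. blocked n (Z w)) \<longrightarrow>
      (\<exists>\<^sub>\<infinity>n. blocked n (Z w) \<and> (\<forall>i\<in>-{a}. Z w (Suc n) $ i - Z w n $ i = reversal n (Z w) i))"
  proof (rule fresh_signs_hit_infinitely_often)
    show "blocked n p = blocked n p'" if eq: "\<And>k. k \<le> n \<Longrightarrow> p k = p' k" for n p p'
    proof -
      have r: "is_record s a n p = is_record s a n p'" by (rule rec_cong) (rule eq)
      have "p n = p' n" "\<And>k. k < n \<Longrightarrow> p k = p' k" "\<And>k. k < n \<Longrightarrow> p (Suc k) = p' (Suc k)"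
        using eq by simp_all
      then show ?thesis unfolding blocked_def r by (simp cong: conj_cong)
    qed
    show "axis_line i (p k) \<noteq> axis_line i (p n)" if "blocked n p" "i \<in> -{a}" "k < n" for n p i k
      by (rule fresh) (use that in \<open>simp_all add: blocked_def\<close>)
    show "reversal n p = reversal n p'" if "\<And>k. k \<le> n \<Longrightarrow> p k = p' k" for n p p'
      by (rule reversal_cong) (rule that)
    show "reversal n (Z w) i \<in> {-1, 1}" if "w \<in> space M" "blocked n (Z w)" for n w i
      by (rule reversal_sign) (use that in \<open>simp_all add: blocked_def\<close>)
  qed
  have AE_unseen: "AE w in M. (\<exists>\<^sub>\<infinity>n. unseen n (Z w)) \<longrightarrow>
      (\<exists>\<^sub>\<infinity>n. unseen n (Z w) \<and> (\<forall>i\<in>UNIV. Z w (Suc n) $ i - Z w n $ i = reversal n (Z w) i))"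
  proof (rule fresh_signs_hit_infinitely_often)
    show "unseen n p = unseen n p'" if eq: "\<And>k. k \<le> n \<Longrightarrow> p k = p' k" for n p p'
    proof -
      have r: "is_record s a n p = is_record s a n p'" by (rule rec_cong) (rule eq)
      have "p n = p' n" "\<And>k. k < n \<Longrightarrow> p k = p' k" "\<And>k. k < n \<Longrightarrow> p (Suc k) = p' (Suc k)"
        using eq by simp_all
      then show ?thesis unfolding unseen_def r by (simp cong: conj_cong)
    qed
    show "axis_line i (p k) \<noteq> axis_line i (p n)" if "unseen n p" "k < n" for n p i k
      using that fresh[of n p i k] unfolding unseen_def by (cases "i = a") auto
    show "reversal n p = reversal n p'" if "\<And>k. k \<le> n \<Longrightarrow> p k = p' k" for n p p'
      by (rule reversal_cong) (rule that)
    show "reversal n (Z w) i \<in> {-1, 1}" if "w \<in> space M" "unseen n (Z w)" for n w i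
      by (rule reversal_sign) (use that in \<open>simp_all add: unseen_def\<close>)
  qed
  have AE_up: "AE w in M. \<forall>h. (\<exists>\<^sub>\<infinity>n. is_record s a n (Z w) \<and> Z w n $ b = h) \<longrightarrow>
      (\<exists>\<^sub>\<infinity>n. (is_record s a n (Z w) \<and> Z w n $ b = h) \<and> (\<forall>i\<in>{b}. Z w (Suc n) $ i - Z w n $ i = 1))"
  proof (subst AE_all_countable, rule allI, rule fresh_signs_hit_infinitely_often)
    show "(is_record s a n p \<and> p n $ b = h) = (is_record s a n p' \<and> p' n $ b = h)"
      if eq: "\<And>k. k \<le> n \<Longrightarrow> p k = p' k" for n p p' h
          proof -
      have "is_record s a n p = is_record s a n p'" by (rule rec_cong) (rule eq)
      then show ?thesis using eq[of n] by simp
    qed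
    show "axis_line i (p k) \<noteq> axis_line i (p n)"
      if "is_record s a n p \<and> p n $ b = h" "i \<in> {b}" "k < n" for n p i k h
      by (rule fresh) (use that \<open>a \<noteq> b\<close> in auto)
  qed simp_all
  have "AE w in M. w \<in> space M" by simp
  with AE_blocked AE_unseen AE_up show ?thesis
  proof eventually_elim
    case (elim w)
    define p where "p = Z w"
    have sgn: "p (Suc n) $ i - p n $ i \<in> {-1, 1}" for n i
      unfolding p_def using elim by (intro step_sign)
    have same: "p (Suc m) $ i - p m $ i = p (Suc n) $ i - p n $ i"
      if "axis_line i (p m) = axis_line i (p n)" for m n i
      using that unfolding p_def by (rule same_line_same_step)
    show ?case unfolding p_def[symmetric]
    proof (intro impI, rule ccontr)
      assume inf: "\<exists>\<^sub>\<infinity>n. is_record s a n p" and no: "\<nexists>n. p (Suc (Suc n)) = p n"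
      have not_back: "\<not> (\<forall>i. p (Suc n) $ i - p n $ i = reversal n p i)" if "0 < n" for n
      proof
        assume *: "\<forall>i. p (Suc n) $ i - p n $ i = reversal n p i"
        have "p (Suc n) $ i = p (n - 1) $ i" for i
          using spec[OF *, of i] unfolding reversal_def by linarith
        then have "p (Suc (Suc (n - 1))) = p (n - 1)" using that by (simp add: vec_eq_iff)
        with no show False by blast
      qed
      have rec_back: "reversal n p a = - s" if "is_record s a n p" "0 < n" for n
      proof -
        have "s * p (n - 1) $ a < s * p n $ a" using that unfolding is_record_def by simp
        moreover have "p n $ a - p (n - 1) $ a \<in> {-1, 1}" using sgn[of "n - 1" a] that by simp
        ultimately show ?thesis using s unfolding reversal_def by auto
      qed
      have "\<not> (\<exists>\<^sub>\<infinity>n. blocked n p)"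
      proof
        assume "\<exists>\<^sub>\<infinity>n. blocked n p"
        from INFM_EX[OF mp[OF elim(1)[folded p_def] this]]
        obtain n where n: "blocked n p" "\<forall>i\<in>-{a}. p (Suc n) $ i - p n $ i = reversal n p i"
          by blast
        then obtain k where "axis_line a (p k) = axis_line a (p n)" "p (Suc k) $ a - p k $ a = - s"
          unfolding blocked_def by blast
        then have "p (Suc n) $ a - p n $ a = - s" using same[of a k n] by simp
        then have "\<forall>i. p (Suc n) $ i - p n $ i = reversal n p i"
          using n rec_back[of n] unfolding blocked_def by force
        then show False using not_back[of n] n unfolding blocked_def by blast
      qed
      moreover have "\<not> (\<exists>\<^sub>\<infinity>n. unseen n p)"
      proof
        assume "\<exists>\<^sub>\<infinity>n. unseen n p"
        from INFM_EX[OF mp[OF elim(2)[folded p_def] this]]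
        obtain n where n: "unseen n p" "\<forall>i. p (Suc n) $ i - p n $ i = reversal n p i"
          by blast
        then show False using not_back[of n] unfolding unseen_def by blast
      qed
      ultimately have "\<forall>\<^sub>\<infinity>n. \<not> blocked n p \<and> \<not> unseen n p"
        by (simp add: not_INFM MOST_conj_distrib)
      then obtain N where N: "\<And>n. n \<ge> N \<Longrightarrow> \<not> blocked n p \<and> \<not> unseen n p"
        unfolding MOST_nat_le by blast
      obtain m where m: "m \<ge> Suc N" "is_record s a m p" using inf unfolding INFM_nat_le by blast
      \<comment> \<open>A late record is neither blocked nor unseen: its line parallel to \<open>a\<close> is known and points
        forwards.\<close>
      have seen: "\<exists>k<n. axis_line a (p k) = axis_line a (p n) \<and> p (Suc n) $ a - p n $ a = s"
        if n: "n \<ge> m" "is_record s a n p" for n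
      proof -
        have "0 < n" "N \<le> n" using n m by auto
        then obtain k where k: "k < n" "axis_line a (p k) = axis_line a (p n)"
          using N[of n] n unfolding unseen_def by blast
        have "p (Suc k) $ a - p k $ a \<noteq> - s"
          using N[of n] n k \<open>0 < n\<close> \<open>N \<le> n\<close> unfolding blocked_def by blast
        then have "p (Suc k) $ a - p k $ a = s" using sgn[of k a] s by auto
        then show ?thesis using k same[of a k n] by auto
      qed
      have rec: "is_record s a n p" if "n \<ge> m" for n
        using that
      proof (induction n rule: dec_induct)
        case base
        show ?case by (rule m)
      next
        case (step n)
        have "p (Suc n) $ a = p n $ a + s" using seen[OF step(1,3)] by auto
        then have "s * p n $ a < s * p (Suc n) $ a" using s by auto
        then show ?case using step(3) unfolding is_record_def by (metis less_Suc_eq order_less_trans)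
      qed
      \<comment> \<open>Following known lines back in time ends before \<open>m\<close>, and two points of the same line agree
        in the coordinate \<open>b\<close>.\<close>
      have "\<exists>k<m. p n $ b = p k $ b" for n
      proof (induction n rule: less_induct)
        case (less n)
        show ?case
        proof (cases "n < m")
          case False
          then obtain k where "k < n" "axis_line a (p k) = axis_line a (p n)"
            using seen[OF _ rec] by (metis not_less)
          then show ?thesis using less \<open>a \<noteq> b\<close> unfolding axis_line_eq_iff by metis
        qed auto
      qed
      then have "range (\<lambda>n. p n $ b) \<subseteq> (\<lambda>n. p n $ b) ` {..<m}" by force
      then have fin: "finite (range (\<lambda>n. p n $ b))" by (rule finite_subset) simp
      then obtain h where h: "infinite {n. p n $ b = h}"
        using pigeonhole_infinite[of "UNIV :: nat set" "\<lambda>n. p n $ b"] by auto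
      have "\<exists>\<^sub>\<infinity>n. p n $ b = h + int j" for j
      proof (induction j)
        case 0
        then show ?case using h by (simp add: INFM_iff_infinite)
      next
        case (Suc j)
        have "\<exists>\<^sub>\<infinity>n. is_record s a n p \<and> p n $ b = h + int j"
          using Suc rec unfolding INFM_nat_le by (meson le_trans nle_le)
        from INFM_mono[OF mp[OF spec[OF elim(3)[folded p_def]] this]]
        have "\<exists>\<^sub>\<infinity>n. p (Suc n) $ b = h + int (Suc j)" by force
        then show ?case unfolding INFM_nat_le by (meson le_Suc_eq)
      qed
      then have "h + int j \<in> range (\<lambda>n. p n $ b)" for j
        by (metis (mono_tags, lifting) INFM_E rangeI)
      then have "range (\<lambda>j. h + int j) \<subseteq> range (\<lambda>n. p n $ b)" by blast
      moreover have "infinite (range (\<lambda>j. h + int j))"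
        by (rule range_inj_infinite) (auto intro: injI)
      ultimately show False using fin finite_subset by blast
    qed
  qed
qed

end

section \<open>Boundedness\<close>

lemma bounded_above_if_finitely_many_records:
  assumes "\<not> (\<exists>\<^sub>\<infinity>n. is_record s i n p)"
  shows "\<exists>c. \<forall>n. s * p n $ i \<le> c"
proof -
  obtain N where N: "\<And>n. n \<ge> N \<Longrightarrow> \<not> is_record s i n p"
    using assms unfolding not_INFM MOST_nat_le by blast
  define c where "c = Max ((\<lambda>k. s * p k $ i) ` {..N})"
  have "s * p n $ i \<le> c" for n
  proof (induction n rule: less_induct)
    case (less n)
    show ?case
    proof (cases "n \<le> N")
      case True
      then show ?thesis unfolding c_def by (intro Max_ge) auto
    next
      case False
      then obtain k where "k < n" "s * p n $ i \<le> s * p k $ i"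
        using N[of n] unfolding is_record_def by (auto simp: not_less)
      then show ?thesis using less[of k] by simp
    qed
  qed
  then show ?thesis by blast
qed

lemma finite_range_walk_if_backtrack:
  assumes reversal: "walk e z (Suc (Suc n)) = walk e z n"
  shows "finite (range (walk e z))"
proof -
  have cycle: "walk e z (n + k) \<in> {walk e z n, walk e z (Suc n)}" for k
  proof (induction k)
    case (Suc k)
    then show ?case using reversal by auto
  qed simp
  then have "walk e z m \<in> walk e z ` {..Suc n}" for m
  proof (cases "m \<le> n")
    case False
    then obtain k where "m = n + k" using le_Suc_ex[of n m] by auto
    then show ?thesis using cycle[of k] by (auto simp del: walk.simps)
  qed simp
  then have "range (walk e z) \<subseteq> walk e z ` {..Suc n}" by blast
  then show ?thesis by (rule finite_subset) simp
qed

theorem proposition2: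
  fixes M :: "'w measure"
    and eps :: "'d::finite \<Rightarrow> (int ^ 'd) set \<Rightarrow> 'w \<Rightarrow> int"
    and z :: "int ^ 'd"
  assumes "CARD('d) \<ge> 2"
    and "prob_space M"
    and "\<And>i l w. l \<in> axis_lines i \<Longrightarrow> w \<in> space M \<Longrightarrow> eps i l w \<in> {-1, 1}"
    and "prob_space.indep_vars M (\<lambda>_. count_space UNIV) (\<lambda>(i, l). eps i l)
           (SIGMA i:UNIV. axis_lines i)"
    and "\<And>i l. l \<in> axis_lines i \<Longrightarrow>
           distr M (count_space UNIV) (eps i l) = measure_pmf (pmf_of_set {-1, 1})"
  shows "AE w in M. bounded (range (\<lambda>n. to_real_vec (walk (\<lambda>i l. eps i l w) z n)))"
proof -
  interpret random_line_orientations M eps z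
    using assms unfolding random_line_orientations_def random_line_orientations_axioms_def by blast
  have other: "\<exists>b. a \<noteq> b" for a :: 'd
  proof (rule ccontr)
    assume "\<nexists>b. a \<noteq> b"
    then have "UNIV = {a}" by (intro UNIV_eq_I) auto
    then have "CARD('d) = 1" by (metis card_1_singleton_iff One_nat_def)
    with assms(1) show False by simp
  qed
  have "AE w in M. (\<exists>\<^sub>\<infinity>n. is_record s a n (Z w)) \<longrightarrow> (\<exists>n. Z w (Suc (Suc n)) = Z w n)"
    if "s \<in> {-1, 1}" for s a
    using other[of a] AE_records_imp_backtrack[OF _ that] by blast
  then have "AE w in M. \<forall>a. \<forall>s\<in>{-1, 1}. (\<exists>\<^sub>\<infinity>n. is_record s a n (Z w)) \<longrightarrow> (\<exists>n. Z w (Suc (Suc n)) = Z w n)"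
    by (simp add: AE_all_countable AE_ball_countable del: walk.simps)
  then show ?thesis
  proof eventually_elim
    case (elim w)
    show ?case
    proof (cases "\<exists>n. Z w (Suc (Suc n)) = Z w n")
      case True
      then have "finite (range (Z w))" using finite_range_walk_if_backtrack by blast
      then have "finite (to_real_vec ` range (Z w))" by simp
      then show ?thesis by (simp add: image_image finite_imp_bounded)
    next
      case False
      then have "\<exists>c. \<forall>n. s * Z w n $ a \<le> c" if "s \<in> {-1, 1}" for s a
        using elim that bounded_above_if_finitely_many_records by blast
      from this[of 1] this[of "-1"] obtain c c' where
        "\<And>a n. Z w n $ a \<le> c a" "\<And>a n. - Z w n $ a \<le> c' a"
        by simp metis
      then have le: "\<bar>Z w n $ a\<bar> \<le> \<bar>c a\<bar> + \<bar>c' a\<bar>" for n a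
        by (smt (verit))
      have "norm (to_real_vec (Z w n)) \<le> (\<Sum>a\<in>UNIV. real_of_int (\<bar>c a\<bar> + \<bar>c' a\<bar>))" for n
      proof -
        have "norm (to_real_vec (Z w n)) \<le> (\<Sum>a\<in>UNIV. \<bar>to_real_vec (Z w n) $ a\<bar>)"
          by (rule norm_le_l1_cart)
        also have "\<dots> \<le> (\<Sum>a\<in>UNIV. real_of_int (\<bar>c a\<bar> + \<bar>c' a\<bar>))"
          by (intro sum_mono) (use le in \<open>simp add: to_real_vec_def flip: of_int_abs of_int_add\<close>)
        finally show ?thesis .
      qed
      then show ?thesis by (intro boundedI) blast
    qed
  qed
qed

end
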